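(* Let $\phi$ be a Paraconsistent Non-dependence Logic sentence that is consistent. Then $\phi$ is logically equivalent to its flattening $\phi^f$, that is, for all models $M$ over the signature of $\phi$ and all $d\in\{+,-\}$, $M\models_P^d\phi$ if and only if $M\models_P^d\phi^f$.
   Context: A sentence $\phi$ is consistent if there is no model $M$ such that both $M\models_P^+\phi$ and $M\models_P^-\phi$. The flattening $\psi^f$ of a formula $\psi$ is the first-order formula defined recursively by: $\psi^f=\psi$ for first-order atoms; $({=}(\vec t_1,\vec t_2))^f=\top$; $(\lnot\psi)^f=\lnot(\psi^f)$; $(\psi\vee\theta)^f=\psi^f\vee\theta^f$; $(\exists v\psi)^f=\exists v(\psi^f)$. Here $\top$ is an always-true first-order sentence. Syntax. Over a first-order signature $\Sigma$, the formulas of Paraconsistent Non-dependence Logic are $\psi ::= R\vec t \mid t_1=t_2 \mid {=}(\vec t_1,\vec t_2) \mid \lnot\psi \mid \psi\vee\psi \mid \exists v\,\psi$, where $\vec t,\vec t_1,\vec t_2$ are (possibly empty) tuples of $\Sigma$-terms; ${=}(\vec t_1,\vec t_2)$ is called a dependence atom. $\psi\wedge\theta$ abbreviates $\lnot(\lnot\psi\vee\lnot\theta)$ and $\forall v\,\psi$ abbreviates $\lnot\exists v\lnot\psi$. Free variables are defined as usual (all variables in an atom, including dependence atoms, are free); a sentence is a formula with no free variables. Teams. Models have nonempty domain. A team over $M$ with domain $V$ is a set $X$ of assignments $s:V\to\mathrm{Dom}(M)$. $\vec t\langle s\rangle$ denotes the value of the tuple $\vec t$ under $s$. Games. Let $\mathrm{Free}(\psi)\subseteq\mathrm{Dom}(X)$.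 The game $G^M_X(\psi)$ is played by Eloise and Abelard; $\alpha^*$ denotes the opponent of $\alpha$. Positions are triples $(\chi,s,\alpha)$ with $\chi$ an occurrence of a subformula of $\psi$, $s$ an assignment and $\alpha$ a player; the possible starting positions are $(\psi,s,\text{Eloise})$ for $s\in X$. Rules: at $(R\vec t,s,\alpha)$ or $(t_1=t_2,s,\alpha)$, $\alpha$ wins if the atom is true in $M$ under $s$, otherwise $\alpha^*$ wins; at $({=}(\vec t_1,\vec t_2),s,\alpha)$, $\alpha$ wins; from $(\lnot\chi,s,\alpha)$ the game moves to $(\chi,s,\alpha^* )$; from $(\chi\vee\theta,s,\alpha)$, $\alpha$ chooses $(\chi,s,\alpha)$ or $(\theta,s,\alpha)$; from $(\exists v\chi,s,\alpha)$, $\alpha$ chooses $m\in\mathrm{Dom}(M)$ and the game moves to $(\chi,s[m/v],\alpha)$. A (possibly nondeterministic) strategy for a player selects a nonempty set of allowed successors at each position where that player chooses; it is winning if every play from any starting position in which the player's choices conform to it is won by that player. A strategy for $\alpha$ is uniform if for any two plays conforming to it and ending in $({=}(\vec t_1,\vec t_2),s,\alpha)$ and $({=}(\vec t_1,\vec t_2),s',\alpha)$ for the same occurrence of the dependence atom, $\vec t_1\langle s\rangle=\vec t_1\langle s'\rangle$ implies $\vec t_2\langle s\rangle=\vec t_2\langle s'\rangle$. Paraconsistent satisfaction. $(M,X)\models_P^+\psi$ iff Abelard has no uniform winning strategy in $G^M_X(\psi)$; $(M,X)\models_P^-\psi$ iff Eloise has no uniform winning strategy in $G^M_X(\psi)$.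 For a sentence $\phi$, $M\models_P^{\pm}\phi$ means $(M,\{\emptyset\})\models_P^{\pm}\phi$, where $\{\emptyset\}$ is the team containing only the empty assignment. *)

theory Defs
  imports Main
begin

section \<open>Syntax\<close>

text \<open>A symbol belongs to the signature iff its arity is defined, so a signature may have
  no function symbols or no relation symbols at all. Constants are nullary function symbols.\<close>

record ('f, 'r) signature =
  fun_arity :: "'f \<rightharpoonup> nat"
  rel_arity :: "'r \<rightharpoonup> nat"

type_synonym var = nat

datatype 'f trm = Var var | Fn 'f "'f trm list"

datatype ('f, 'r) fm =
    Rel 'r "'f trm list"
  | Eq "'f trm" "'f trm"
  | Dep "'f trm list" "'f trm list"
  | Neg "('f, 'r) fm"
  | Or "('f, 'r) fm" "('f, 'r) fm"
  | Ex var "('f, 'r) fm"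

abbreviation And :: "('f, 'r) fm \<Rightarrow> ('f, 'r) fm \<Rightarrow> ('f, 'r) fm" where
  "And \<psi> \<theta> \<equiv> Neg (Or (Neg \<psi>) (Neg \<theta>))"

abbreviation All :: "var \<Rightarrow> ('f, 'r) fm \<Rightarrow> ('f, 'r) fm" where
  "All v \<psi> \<equiv> Neg (Ex v (Neg \<psi>))"

primrec wf_trm :: "('f, 'r) signature \<Rightarrow> 'f trm \<Rightarrow> bool" where
  "wf_trm \<Sigma> (Var v) \<longleftrightarrow> True"
| "wf_trm \<Sigma> (Fn f ts) \<longleftrightarrow> fun_arity \<Sigma> f = Some (length ts) \<and> list_all (wf_trm \<Sigma>) ts"

primrec wf_fm :: "('f, 'r) signature \<Rightarrow> ('f, 'r) fm \<Rightarrow> bool" where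
  "wf_fm \<Sigma> (Rel R ts) \<longleftrightarrow> rel_arity \<Sigma> R = Some (length ts) \<and> list_all (wf_trm \<Sigma>) ts"
| "wf_fm \<Sigma> (Eq t u) \<longleftrightarrow> wf_trm \<Sigma> t \<and> wf_trm \<Sigma> u"
| "wf_fm \<Sigma> (Dep ts us) \<longleftrightarrow> list_all (wf_trm \<Sigma>) ts \<and> list_all (wf_trm \<Sigma>) us"
| "wf_fm \<Sigma> (Neg \<psi>) \<longleftrightarrow> wf_fm \<Sigma> \<psi>"
| "wf_fm \<Sigma> (Or \<psi> \<theta>) \<longleftrightarrow> wf_fm \<Sigma> \<psi> \<and> wf_fm \<Sigma> \<theta>"
| "wf_fm \<Sigma> (Ex v \<psi>) \<longleftrightarrow> wf_fm \<Sigma> \<psi>"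

primrec vars_trm :: "'f trm \<Rightarrow> var set" where
  "vars_trm (Var v) = {v}"
| "vars_trm (Fn f ts) = \<Union> (set (map vars_trm ts))"

primrec free :: "('f, 'r) fm \<Rightarrow> var set" where
  "free (Rel R ts) = (\<Union>t\<in>set ts. vars_trm t)"
| "free (Eq t u) = vars_trm t \<union> vars_trm u"
| "free (Dep ts us) = (\<Union>t\<in>set ts \<union> set us. vars_trm t)"
| "free (Neg \<psi>) = free \<psi>"
| "free (Or \<psi> \<theta>) = free \<psi> \<union> free \<theta>"
| "free (Ex v \<psi>) = free \<psi> - {v}"

definition sentence :: "('f, 'r) signature \<Rightarrow> ('f, 'r) fm \<Rightarrow> bool" where
  "sentence \<Sigma> \<phi> \<longleftrightarrow> wf_fm \<Sigma> \<phi> \<and> free \<phi> = {}"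

text \<open>The syntax has no constant for truth; we use a valid first-order sentence that is
  available over every signature.\<close>

definition Top :: "('f, 'r) fm" where
  "Top = All 0 (Eq (Var 0) (Var 0))"

primrec flatten :: "('f, 'r) fm \<Rightarrow> ('f, 'r) fm" where
  "flatten (Rel R ts) = Rel R ts"
| "flatten (Eq t u) = Eq t u"
| "flatten (Dep ts us) = Top"
| "flatten (Neg \<psi>) = Neg (flatten \<psi>)"
| "flatten (Or \<psi> \<theta>) = Or (flatten \<psi>) (flatten \<theta>)"
| "flatten (Ex v \<psi>) = Ex v (flatten \<psi>)"

lemma sentence_flatten: "sentence \<Sigma> \<phi> \<Longrightarrow> sentence \<Sigma> (flatten \<phi>)"
proof -
  have "wf_fm \<Sigma> \<psi> \<Longrightarrow> wf_fm \<Sigma> (flatten \<psi>)" for \<psi>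
    by (induction \<psi>) (auto simp: Top_def)
  moreover have "free (flatten \<psi>) \<subseteq> free \<psi>" for \<psi> :: "('a, 'b) fm"
    by (induction \<psi>) (auto simp: Top_def)
  ultimately show "sentence \<Sigma> \<phi> \<Longrightarrow> sentence \<Sigma> (flatten \<phi>)"
    unfolding sentence_def by blast
qed


section \<open>Models and teams\<close>

record ('f, 'r, 'm) model =
  Dom :: "'m set"
  fun_interp :: "'f \<Rightarrow> 'm list \<Rightarrow> 'm"
  rel_interp :: "'r \<Rightarrow> 'm list set"

definition is_model :: "('f, 'r) signature \<Rightarrow> ('f, 'r, 'm) model \<Rightarrow> bool" where
  "is_model \<Sigma> M \<longleftrightarrow>
     Dom M \<noteq> {} \<and>
     (\<forall>f n ms. fun_arity \<Sigma> f = Some n \<and> length ms = n \<and> set ms \<subseteq> Dom M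
        \<longrightarrow> fun_interp M f ms \<in> Dom M) \<and>
     (\<forall>R n ms. rel_arity \<Sigma> R = Some n \<and> ms \<in> rel_interp M R
        \<longrightarrow> length ms = n \<and> set ms \<subseteq> Dom M)"

text \<open>An assignment with domain \<open>V\<close> is a partial map \<open>s\<close> with \<open>dom s = V\<close>.\<close>

type_synonym 'm assignment = "var \<rightharpoonup> 'm"

definition is_team :: "('f, 'r, 'm) model \<Rightarrow> var set \<Rightarrow> 'm assignment set \<Rightarrow> bool" where
  "is_team M V X \<longleftrightarrow> (\<forall>s\<in>X. dom s = V \<and> ran s \<subseteq> Dom M)"

lemma is_team_empty_assignment: "is_team M {} {Map.empty}"
  by (simp add: is_team_def)

text \<open>The value is meaningful only if \<open>s\<close> is defined on all variables of the term.\<close>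

primrec eval :: "('f, 'r, 'm) model \<Rightarrow> 'm assignment \<Rightarrow> 'f trm \<Rightarrow> 'm" where
  "eval M s (Var v) = the (s v)"
| "eval M s (Fn f ts) = fun_interp M f (map (eval M s) ts)"

abbreviation evals :: "('f, 'r, 'm) model \<Rightarrow> 'm assignment \<Rightarrow> 'f trm list \<Rightarrow> 'm list" where
  "evals M s ts \<equiv> map (eval M s) ts"


section \<open>Games\<close>

datatype player = Eloise | Abelard

fun opponent :: "player \<Rightarrow> player" where
  "opponent Eloise = Abelard"
| "opponent Abelard = Eloise"

text \<open>An occurrence of a subformula of \<open>\<psi>\<close> is given by the path leading to it from the root
  of \<open>\<psi>\<close>, so that distinct occurrences of the same formula are kept apart.\<close>

datatype direction = Down | LeftArg | RightArg

type_synonym occurrence = "direction list"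

fun subfm_at :: "('f, 'r) fm \<Rightarrow> occurrence \<Rightarrow> ('f, 'r) fm option" where
  "subfm_at \<psi> [] = Some \<psi>"
| "subfm_at (Neg \<psi>) (Down # p) = subfm_at \<psi> p"
| "subfm_at (Or \<psi> \<theta>) (LeftArg # p) = subfm_at \<psi> p"
| "subfm_at (Or \<psi> \<theta>) (RightArg # p) = subfm_at \<theta> p"
| "subfm_at (Ex v \<psi>) (Down # p) = subfm_at \<psi> p"
| "subfm_at _ _ = None"

type_synonym 'm position = "occurrence \<times> 'm assignment \<times> player"

definition positions :: "('f, 'r, 'm) model \<Rightarrow> ('f, 'r) fm \<Rightarrow> 'm position set" where
  "positions M \<psi> = {(p, s, \<alpha>). subfm_at \<psi> p \<noteq> None \<and> ran s \<subseteq> Dom M}"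

definition starts :: "'m assignment set \<Rightarrow> 'm position set" where
  "starts X = {([], s, Eloise) |s. s \<in> X}"

fun moves :: "('f, 'r, 'm) model \<Rightarrow> ('f, 'r) fm \<Rightarrow> 'm position \<Rightarrow> 'm position set" where
  "moves M \<psi> (p, s, \<alpha>) =
     (case subfm_at \<psi> p of
        Some (Neg \<chi>) \<Rightarrow> {(p @ [Down], s, opponent \<alpha>)}
      | Some (Or \<chi> \<theta>) \<Rightarrow> {(p @ [LeftArg], s, \<alpha>), (p @ [RightArg], s, \<alpha>)}
      | Some (Ex v \<chi>) \<Rightarrow> {(p @ [Down], s(v \<mapsto> m), \<alpha>) |m. m \<in> Dom M}
      | _ \<Rightarrow> {})"

fun chooses :: "('f, 'r) fm \<Rightarrow> player \<Rightarrow> 'm position \<Rightarrow> bool" where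
  "chooses \<psi> \<beta> (p, s, \<alpha>) \<longleftrightarrow> \<beta> = \<alpha> \<and>
     (case subfm_at \<psi> p of Some (Or \<chi> \<theta>) \<Rightarrow> True | Some (Ex v \<chi>) \<Rightarrow> True | _ \<Rightarrow> False)"

text \<open>The value \<open>None\<close> marks the positions at which the game is not over.\<close>

fun winner :: "('f, 'r, 'm) model \<Rightarrow> ('f, 'r) fm \<Rightarrow> 'm position \<Rightarrow> player option" where
  "winner M \<psi> (p, s, \<alpha>) =
     (case subfm_at \<psi> p of
        Some (Rel R ts) \<Rightarrow> Some (if evals M s ts \<in> rel_interp M R then \<alpha> else opponent \<alpha>)
      | Some (Eq t u) \<Rightarrow> Some (if eval M s t = eval M s u then \<alpha> else opponent \<alpha>)
      | Some (Dep ts us) \<Rightarrow> Some \<alpha>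
      | _ \<Rightarrow> None)"

text \<open>Plays are complete, that is, they run from a starting position to an atom.\<close>

definition is_play ::
  "('f, 'r, 'm) model \<Rightarrow> 'm assignment set \<Rightarrow> ('f, 'r) fm \<Rightarrow> 'm position list \<Rightarrow> bool" where
  "is_play M X \<psi> \<pi> \<longleftrightarrow>
     \<pi> \<noteq> [] \<and> hd \<pi> \<in> starts X \<and>
     (\<forall>i. Suc i < length \<pi> \<longrightarrow> \<pi> ! Suc i \<in> moves M \<psi> (\<pi> ! i)) \<and>
     winner M \<psi> (last \<pi>) \<noteq> None"

type_synonym 'm strategy = "'m position \<Rightarrow> 'm position set"

text \<open>Only the values of \<open>\<sigma>\<close> at positions where \<open>\<beta>\<close> chooses are relevant.\<close>

definition is_strategy ::
  "('f, 'r, 'm) model \<Rightarrow> ('f, 'r) fm \<Rightarrow> player \<Rightarrow> 'm strategy \<Rightarrow> bool" where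
  "is_strategy M \<psi> \<beta> \<sigma> \<longleftrightarrow>
     (\<forall>q\<in>positions M \<psi>. chooses \<psi> \<beta> q \<longrightarrow> \<sigma> q \<noteq> {} \<and> \<sigma> q \<subseteq> moves M \<psi> q)"

definition conforms ::
  "('f, 'r) fm \<Rightarrow> player \<Rightarrow> 'm strategy \<Rightarrow> 'm position list \<Rightarrow> bool" where
  "conforms \<psi> \<beta> \<sigma> \<pi> \<longleftrightarrow>
     (\<forall>i. Suc i < length \<pi> \<and> chooses \<psi> \<beta> (\<pi> ! i) \<longrightarrow> \<pi> ! Suc i \<in> \<sigma> (\<pi> ! i))"

definition winning ::
  "('f, 'r, 'm) model \<Rightarrow> 'm assignment set \<Rightarrow> ('f, 'r) fm \<Rightarrow> player \<Rightarrow> 'm strategy \<Rightarrow> bool"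
where
  "winning M X \<psi> \<beta> \<sigma> \<longleftrightarrow>
     (\<forall>\<pi>. is_play M X \<psi> \<pi> \<and> conforms \<psi> \<beta> \<sigma> \<pi> \<longrightarrow> winner M \<psi> (last \<pi>) = Some \<beta>)"

definition uniform ::
  "('f, 'r, 'm) model \<Rightarrow> 'm assignment set \<Rightarrow> ('f, 'r) fm \<Rightarrow> player \<Rightarrow> 'm strategy \<Rightarrow> bool"
where
  "uniform M X \<psi> \<beta> \<sigma> \<longleftrightarrow>
     (\<forall>\<pi> \<pi>' p s s' ts us.
        is_play M X \<psi> \<pi> \<and> conforms \<psi> \<beta> \<sigma> \<pi> \<and> last \<pi> = (p, s, \<beta>) \<and>
        is_play M X \<psi> \<pi>' \<and> conforms \<psi> \<beta> \<sigma> \<pi>' \<and> last \<pi>' = (p, s', \<beta>) \<and>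
        subfm_at \<psi> p = Some (Dep ts us) \<and> evals M s ts = evals M s' ts
        \<longrightarrow> evals M s us = evals M s' us)"

definition has_uniform_winning_strategy ::
  "('f, 'r, 'm) model \<Rightarrow> 'm assignment set \<Rightarrow> ('f, 'r) fm \<Rightarrow> player \<Rightarrow> bool" where
  "has_uniform_winning_strategy M X \<psi> \<beta> \<longleftrightarrow>
     (\<exists>\<sigma>. is_strategy M \<psi> \<beta> \<sigma> \<and> winning M X \<psi> \<beta> \<sigma> \<and> uniform M X \<psi> \<beta> \<sigma>)"


section \<open>Paraconsistent satisfaction\<close>

datatype sign = Plus | Minus

text \<open>Intended for models \<open>M\<close> and teams \<open>X\<close> over \<open>M\<close> whose domain contains \<open>free \<psi>\<close>.\<close>

fun team_sat ::
  "sign \<Rightarrow> ('f, 'r, 'm) model \<Rightarrow> 'm assignment set \<Rightarrow> ('f, 'r) fm \<Rightarrow> bool" where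
  "team_sat Plus M X \<psi> \<longleftrightarrow> \<not> has_uniform_winning_strategy M X \<psi> Abelard"
| "team_sat Minus M X \<psi> \<longleftrightarrow> \<not> has_uniform_winning_strategy M X \<psi> Eloise"

definition sat :: "sign \<Rightarrow> ('f, 'r, 'm) model \<Rightarrow> ('f, 'r) fm \<Rightarrow> bool" where
  "sat d M \<phi> \<longleftrightarrow> team_sat d M {Map.empty} \<phi>"

text \<open>HOL cannot quantify over types inside a formula, so the universe \<open>'m\<close> in which the
  domains of the models live is a parameter. Domains are arbitrary nonempty subsets of it.
  A sentence that is consistent in the absolute sense is consistent for every choice of \<open>'m\<close>.\<close>

definition consistent :: "'m itself \<Rightarrow> ('f, 'r) signature \<Rightarrow> ('f, 'r) fm \<Rightarrow> bool" where
  "consistent (T :: 'm itself) \<Sigma> \<phi> \<longleftrightarrow>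
     \<not> (\<exists>M :: ('f, 'r, 'm) model. is_model \<Sigma> M \<and> sat Plus M \<phi> \<and> sat Minus M \<phi>)"

definition logically_equivalent ::
  "'m itself \<Rightarrow> ('f, 'r) signature \<Rightarrow> ('f, 'r) fm \<Rightarrow> ('f, 'r) fm \<Rightarrow> bool" where
  "logically_equivalent (T :: 'm itself) \<Sigma> \<phi> \<psi> \<longleftrightarrow>
     (\<forall>(M :: ('f, 'r, 'm) model) d. is_model \<Sigma> M \<longrightarrow> sat d M \<phi> = sat d M \<psi>)"

end

theory Submission
  imports Defs
begin

text \<open>Without the uniformity requirement, the holder of a dependence atom simply wins there, so
  dependence atoms behave like \<open>\<top>\<close> and a winning strategy for either player decides the
  first-order truth value of \<open>\<phi>\<^sup>f\<close>. Hence a uniform winning strategy for \<open>\<phi>\<close> yields one for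
  \<open>\<phi>\<^sup>f\<close>, where uniformity is vacuous, and in no game do both players have one. Consistency says
  that in the game of \<open>\<phi>\<close> at least one player has a uniform winning strategy; it must then be the
  same player as for \<open>\<phi>\<^sup>f\<close>.\<close>

section \<open>First-order truth and subformula occurrences\<close>

text \<open>Recursion on \<open>\<psi>\<close> itself, not on \<open>flatten \<psi>\<close>, lets
  truth be read off at the occurrences met in the game of \<open>\<psi>\<close>.\<close>

primrec holds :: "('f, 'r, 'm) model \<Rightarrow> 'm assignment \<Rightarrow> ('f, 'r) fm \<Rightarrow> bool" where
  "holds M s (Rel R ts) \<longleftrightarrow> evals M s ts \<in> rel_interp M R"
| "holds M s (Eq t u) \<longleftrightarrow> eval M s t = eval M s u"
| "holds M s (Dep ts us) \<longleftrightarrow> True"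
| "holds M s (Neg \<psi>) \<longleftrightarrow> \<not> holds M s \<psi>"
| "holds M s (Or \<psi> \<theta>) \<longleftrightarrow> holds M s \<psi> \<or> holds M s \<theta>"
| "holds M s (Ex v \<psi>) \<longleftrightarrow> (\<exists>m\<in>Dom M. holds M (s(v \<mapsto> m)) \<psi>)"

lemma holds_flatten [simp]: "holds M s (flatten \<psi>) \<longleftrightarrow> holds M s \<psi>"
  by (induction \<psi> arbitrary: s) (simp_all add: Top_def)

text \<open>Moves extend a path at its end, while \<open>subfm_at\<close> recurses from its
  front.\<close>

lemma subfm_at_append:
  "subfm_at \<psi> (p @ q) = (case subfm_at \<psi> p of None \<Rightarrow> None | Some \<chi> \<Rightarrow> subfm_at \<chi> q)"
  by (induction \<psi> p rule: subfm_at.induct) simp_all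

lemma subfm_at_Top: "subfm_at Top p \<noteq> Some (Dep ts us)"
proof
  assume "subfm_at Top p = Some (Dep ts us)"
  then show False
    by (auto simp: Top_def elim!: subfm_at.elims subfm_at.elims[OF sym[of "Some (Dep ts us)"]])
qed

lemma subfm_at_flatten: "subfm_at (flatten \<psi>) p \<noteq> Some (Dep ts us)"
proof (induction \<psi> p rule: subfm_at.induct)
  case (1 \<psi>)
  then show ?case by (cases \<psi>) (simp_all add: Top_def)
\<comment> \<open>A nonempty path below a \<open>Dep\<close> leads nowhere in \<open>\<psi>\<close>,
  but in the flattening it may enter \<open>Top\<close>.\<close>
qed (simp_all add: subfm_at_Top)

lemma opponent_eq [simp]: "opponent \<alpha> = \<beta> \<longleftrightarrow> \<alpha> \<noteq> \<beta>"
  by (cases \<alpha>; cases \<beta>) simp_all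

section \<open>Positions reached under a strategy\<close>

text \<open>These are the ends of conforming initial segments of plays, complete or not, so
  invariants of a strategy become rule inductions.\<close>

inductive reachable ::
  "('f, 'r, 'm) model \<Rightarrow> 'm assignment set \<Rightarrow> ('f, 'r) fm \<Rightarrow> player \<Rightarrow> 'm strategy
    \<Rightarrow> 'm position \<Rightarrow> bool"
  for M X \<psi> \<beta> \<sigma> where
  start: "q \<in> starts X \<Longrightarrow> reachable M X \<psi> \<beta> \<sigma> q"
| step: "reachable M X \<psi> \<beta> \<sigma> q \<Longrightarrow> q' \<in> moves M \<psi> q \<Longrightarrow> (chooses \<psi> \<beta> q \<Longrightarrow> q' \<in> \<sigma> q)
    \<Longrightarrow> reachable M X \<psi> \<beta> \<sigma> q'"

lemma reachable_partial_play:
  assumes "reachable M X \<psi> \<beta> \<sigma> q"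
  obtains \<pi> where "\<pi> \<noteq> []" "hd \<pi> \<in> starts X" "last \<pi> = q" "conforms \<psi> \<beta> \<sigma> \<pi>"
    "\<And>i. Suc i < length \<pi> \<Longrightarrow> \<pi> ! Suc i \<in> moves M \<psi> (\<pi> ! i)"
  using assms
proof (induction arbitrary: thesis)
  case (start q)
  show ?case
    by (rule start.prems[of "[q]"]) (use start.hyps in \<open>auto simp: conforms_def\<close>)
next
  case (step q q')
  obtain \<pi> where \<pi>: "\<pi> \<noteq> []" "hd \<pi> \<in> starts X" "last \<pi> = q" "conforms \<psi> \<beta> \<sigma> \<pi>"
    "\<And>i. Suc i < length \<pi> \<Longrightarrow> \<pi> ! Suc i \<in> moves M \<psi> (\<pi> ! i)"
    using step.IH by blast
  have "(\<pi> @ [q']) ! Suc i \<in> moves M \<psi> ((\<pi> @ [q']) ! i) \<and>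
    (chooses \<psi> \<beta> ((\<pi> @ [q']) ! i) \<longrightarrow> (\<pi> @ [q']) ! Suc i \<in> \<sigma> ((\<pi> @ [q']) ! i))"
    if "Suc i < length (\<pi> @ [q'])" for i
  proof (cases "Suc i < length \<pi>")
    case True
    then show ?thesis
      using \<pi>(4,5) by (simp add: nth_append conforms_def)
  next
    case False
    with that have i: "Suc i = length \<pi>" by simp
    then have "\<pi> ! i = q"
      using \<pi>(1,3) by (metis diff_Suc_1 last_conv_nth)
    with i step.hyps show ?thesis
      by (simp add: nth_append)
  qed
  then show ?case
    using \<pi>(1,2) by (intro step.prems[of "\<pi> @ [q']"]) (auto simp: conforms_def)
qed

lemma play_reachable:
  assumes "is_play M X \<psi> \<pi>" "conforms \<psi> \<beta> \<sigma> \<pi>"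
  shows "reachable M X \<psi> \<beta> \<sigma> (last \<pi>)"
proof -
  have "reachable M X \<psi> \<beta> \<sigma> (\<pi> ! i)" if "i < length \<pi>" for i
    using that
  proof (induction i)
    case 0
    then show ?case
      using assms by (auto simp: is_play_def hd_conv_nth intro: reachable.start)
  next
    case (Suc i)
    then show ?case
      using assms by (auto simp: is_play_def conforms_def intro: reachable.step[of _ _ _ _ _ "\<pi> ! i"])
  qed
  then show ?thesis
    using assms by (simp add: is_play_def last_conv_nth)
qed

text \<open>A conforming segment that ends at a position with a winner is already a complete play,
  so \<open>winning\<close> applies to it.\<close>

lemma winning_reachable:
  assumes "winning M X \<psi> \<beta> \<sigma>" "reachable M X \<psi> \<beta> \<sigma> q" "winner M \<psi> q \<noteq> None"
  shows "winner M \<psi> q = Some \<beta>"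
proof -
  obtain \<pi> where "\<pi> \<noteq> []" "hd \<pi> \<in> starts X" "last \<pi> = q" "conforms \<psi> \<beta> \<sigma> \<pi>"
    "\<And>i. Suc i < length \<pi> \<Longrightarrow> \<pi> ! Suc i \<in> moves M \<psi> (\<pi> ! i)"
    using reachable_partial_play[OF assms(2)] by blast
  then show ?thesis
    using assms(1,3) by (auto simp: winning_def is_play_def)
qed

section \<open>From winning strategies to truth\<close>

text \<open>Induction on the subformula, from the atoms up. Where \<open>\<beta>\<close> chooses,
  one reachable successor supplies the true disjunct or instance; where the opponent chooses, all
  successors are reachable and hence false.\<close>

lemma winning_imp_holds:
  assumes "is_strategy M \<psi> \<beta> \<sigma>" "winning M X \<psi> \<beta> \<sigma>"
    and "reachable M X \<psi> \<beta> \<sigma> (p, s, \<alpha>)" "subfm_at \<psi> p = Some \<chi>" "ran s \<subseteq> Dom M"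
  shows "holds M s \<chi> \<longleftrightarrow> \<alpha> = \<beta>"
proof -
  \<comment> \<open>\<open>is_strategy\<close> constrains \<open>\<sigma>\<close> only on
    \<open>positions\<close>, hence the condition on \<open>ran s\<close>.\<close>
  have strategy_moves: "\<sigma> (p, s, \<alpha>) \<noteq> {} \<and> \<sigma> (p, s, \<alpha>) \<subseteq> moves M \<psi> (p, s, \<alpha>)"
    if "subfm_at \<psi> p = Some \<chi>" "ran s \<subseteq> Dom M" "chooses \<psi> \<beta> (p, s, \<alpha>)" for p s \<alpha> \<chi>
  proof -
    have "(p, s, \<alpha>) \<in> positions M \<psi>"
      using that(1,2) by (simp add: positions_def)
    with assms(1) that(3) show ?thesis
      unfolding is_strategy_def by blast
  qed
  show ?thesis
    using assms(3-)
  proof (induction \<chi> arbitrary: p s \<alpha>)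
    case (Rel R ts)
    then show ?case
      using winning_reachable[OF assms(2) Rel.prems(1)] by (auto split: if_splits)
  next
    case (Eq t u)
    then show ?case
      using winning_reachable[OF assms(2) Eq.prems(1)] by (auto split: if_splits)
  next
    case (Dep ts us)
    then show ?case
      using winning_reachable[OF assms(2) Dep.prems(1)] by auto
  next
    case (Neg \<chi>)
    have "reachable M X \<psi> \<beta> \<sigma> (p @ [Down], s, opponent \<alpha>)"
      using Neg.prems by (intro reachable.step[OF Neg.prems(1)]) auto
    \<comment> \<open>Negation flips the truth value and the player together, which preserves the
      equivalence.\<close>
    then show ?case
      using Neg by (fastforce simp: subfm_at_append)
  next
    case (Or \<chi> \<theta>)
    let ?l = "(p @ [LeftArg], s, \<alpha>)" and ?r = "(p @ [RightArg], s, \<alpha>)"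
    have l: "holds M s \<chi> \<longleftrightarrow> \<alpha> = \<beta>" if "reachable M X \<psi> \<beta> \<sigma> ?l"
      using Or.IH(1)[OF that] Or.prems by (simp add: subfm_at_append)
    have r: "holds M s \<theta> \<longleftrightarrow> \<alpha> = \<beta>" if "reachable M X \<psi> \<beta> \<sigma> ?r"
      using Or.IH(2)[OF that] Or.prems by (simp add: subfm_at_append)
    show ?case
    proof (cases "\<alpha> = \<beta>")
      case True
      then have "\<sigma> (p, s, \<alpha>) \<noteq> {} \<and> \<sigma> (p, s, \<alpha>) \<subseteq> {?l, ?r}"
        using strategy_moves[OF Or.prems(2,3)] Or.prems(2) by simp
      then have "?l \<in> \<sigma> (p, s, \<alpha>) \<or> ?r \<in> \<sigma> (p, s, \<alpha>)"
        by blast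
      then have "reachable M X \<psi> \<beta> \<sigma> ?l \<or> reachable M X \<psi> \<beta> \<sigma> ?r"
        using Or.prems by (auto intro: reachable.step[OF Or.prems(1)])
      with l r True show ?thesis by auto
    next
      case False
      then have "reachable M X \<psi> \<beta> \<sigma> ?l" "reachable M X \<psi> \<beta> \<sigma> ?r"
        using Or.prems by (auto intro!: reachable.step[OF Or.prems(1)])
      with l r False show ?thesis by simp
    qed
  next
    case (Ex v \<chi>)
    let ?c = "\<lambda>m. (p @ [Down], s(v \<mapsto> m), \<alpha>)"
    have c: "holds M (s(v \<mapsto> m)) \<chi> \<longleftrightarrow> \<alpha> = \<beta>" if "reachable M X \<psi> \<beta> \<sigma> (?c m)" "m \<in> Dom M" for m
    proof -
      have "ran (s(v \<mapsto> m)) \<subseteq> Dom M"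
        using Ex.prems(3) that(2) by (auto simp: ran_def)
      then show ?thesis
        by (rule Ex.IH[OF that(1), rotated]) (simp add: subfm_at_append Ex.prems(2))
    qed
    show ?case
    proof (cases "\<alpha> = \<beta>")
      case True
      then have "\<sigma> (p, s, \<alpha>) \<noteq> {} \<and> \<sigma> (p, s, \<alpha>) \<subseteq> {?c m |m. m \<in> Dom M}"
        using strategy_moves[OF Ex.prems(2,3)] Ex.prems(2) by simp
      then obtain m where "m \<in> Dom M" "?c m \<in> \<sigma> (p, s, \<alpha>)"
        by blast
      moreover from this have "reachable M X \<psi> \<beta> \<sigma> (?c m)"
        using Ex.prems by (intro reachable.step[OF Ex.prems(1)]) auto
      ultimately show ?thesis using c True by auto
    next
      case False
      then have "reachable M X \<psi> \<beta> \<sigma> (?c m)" if "m \<in> Dom M" for m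
        using Ex.prems that by (intro reachable.step[OF Ex.prems(1)]) auto
      with c False show ?thesis by simp
    qed
qed
qed

section \<open>From truth to winning strategies\<close>

text \<open>The equivalence of \<open>winning_imp_holds\<close>, now taken as an invariant for
  \<open>\<beta>\<close> to maintain.\<close>

fun favourable :: "('f, 'r, 'm) model \<Rightarrow> ('f, 'r) fm \<Rightarrow> player \<Rightarrow> 'm position \<Rightarrow> bool" where
  "favourable M \<psi> \<beta> (p, s, \<alpha>) \<longleftrightarrow>
     (\<exists>\<chi>. subfm_at \<psi> p = Some \<chi> \<and> (holds M s \<chi> \<longleftrightarrow> \<alpha> = \<beta>))"

text \<open>Keeping all favourable moves avoids picking a witness. The \<open>else\<close> branch
  keeps the set nonempty at positions already lost, where \<open>is_strategy\<close> still demands a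
  choice.\<close>

definition favourable_moves :: "('f, 'r, 'm) model \<Rightarrow> ('f, 'r) fm \<Rightarrow> player \<Rightarrow> 'm strategy" where
  "favourable_moves M \<psi> \<beta> q =
     (if \<exists>q'\<in>moves M \<psi> q. favourable M \<psi> \<beta> q' then {q'\<in>moves M \<psi> q. favourable M \<psi> \<beta> q'}
      else moves M \<psi> q)"

lemma is_strategy_favourable_moves:
  assumes "Dom M \<noteq> {}"
  shows "is_strategy M \<psi> \<beta> (favourable_moves M \<psi> \<beta>)"
proof -
  \<comment> \<open>At an \<open>Ex\<close> position a move exists because the domain is
    nonempty.\<close>
  have "moves M \<psi> q \<noteq> {}" if "chooses \<psi> \<beta> q" for q
    using that assms by (cases q) (auto split: option.splits fm.splits)
  then show ?thesis
    by (auto simp: is_strategy_def favourable_moves_def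
        simp del: moves.simps chooses.simps favourable.simps)
qed

lemma favourable_chooses:
  assumes "favourable M \<psi> \<beta> q" "chooses \<psi> \<beta> q"
  shows "\<exists>q'\<in>moves M \<psi> q. favourable M \<psi> \<beta> q'"
proof -
  obtain p s \<alpha> where q: "q = (p, s, \<alpha>)"
    by (cases q)
  with assms obtain \<chi> where \<chi>: "subfm_at \<psi> p = Some \<chi>" "holds M s \<chi> \<longleftrightarrow> \<alpha> = \<beta>"
    by auto
  with assms(2) q show ?thesis
    by (cases \<chi>) (auto simp: subfm_at_append)
qed

text \<open>Either the position is a negation, or the opponent chooses at a false disjunction or
  existential, all of whose successors are false.\<close>

lemma favourable_not_chooses:
  assumes "favourable M \<psi> \<beta> q" "\<not> chooses \<psi> \<beta> q" "q' \<in> moves M \<psi> q"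
  shows "favourable M \<psi> \<beta> q'"
proof -
  obtain p s \<alpha> where q: "q = (p, s, \<alpha>)"
    by (cases q)
  with assms obtain \<chi> where \<chi>: "subfm_at \<psi> p = Some \<chi>" "holds M s \<chi> \<longleftrightarrow> \<alpha> = \<beta>"
    by auto
  with assms(2,3) q show ?thesis
    by (cases \<chi>) (auto simp: subfm_at_append)
qed

text \<open>A dependence atom counts as true, so a favourable one is held by \<open>\<beta>\<close>,
  who wins there.\<close>

lemma favourable_winner:
  assumes "favourable M \<psi> \<beta> q" "winner M \<psi> q \<noteq> None"
  shows "winner M \<psi> q = Some \<beta>"
proof -
  obtain p s \<alpha> where q: "q = (p, s, \<alpha>)"
    by (cases q)
  with assms obtain \<chi> where \<chi>: "subfm_at \<psi> p = Some \<chi>" "holds M s \<chi> \<longleftrightarrow> \<alpha> = \<beta>"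
    by auto
  with assms(2) q show ?thesis
    by (cases \<chi>) auto
qed

lemma winning_favourable_moves:
  assumes "\<And>s. s \<in> X \<Longrightarrow> holds M s \<psi> \<longleftrightarrow> \<beta> = Eloise"
  shows "winning M X \<psi> \<beta> (favourable_moves M \<psi> \<beta>)"
proof -
  have "favourable M \<psi> \<beta> q" if "reachable M X \<psi> \<beta> (favourable_moves M \<psi> \<beta>) q" for q
    using that
  proof induction
    case (start q)
    then show ?case
      using assms by (auto simp: starts_def)
  next
    case (step q q')
    then show ?case
      \<comment> \<open>Where \<open>\<beta>\<close> chooses, \<open>favourable_chooses\<close>
        rules out the \<open>else\<close> branch.\<close>
      using favourable_chooses[of M \<psi> \<beta> q] favourable_not_chooses[of M \<psi> \<beta> q q']
      by (auto simp: favourable_moves_def)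
  qed
  then show ?thesis
    unfolding winning_def
    using play_reachable favourable_winner by (blast dest: is_play_def[THEN iffD1])
qed

section \<open>Comparison of the two games\<close>

text \<open>The case of the root, which Eloise holds.\<close>

lemma uniform_winning_strategy_imp_holds:
  assumes "has_uniform_winning_strategy M X \<psi> \<beta>" "s \<in> X" "ran s \<subseteq> Dom M"
  shows "holds M s \<psi> \<longleftrightarrow> \<beta> = Eloise"
proof -
  obtain \<sigma> where \<sigma>: "is_strategy M \<psi> \<beta> \<sigma>" "winning M X \<psi> \<beta> \<sigma>"
    using assms(1) by (auto simp: has_uniform_winning_strategy_def)
  have "reachable M X \<psi> \<beta> \<sigma> ([], s, Eloise)"
    using assms(2) by (auto simp: starts_def intro: reachable.start)
  then show ?thesis
    using winning_imp_holds[OF \<sigma>] assms(3) by fastforce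
qed

lemma uniform_winning_strategy_flatten:
  assumes "Dom M \<noteq> {}" "\<And>s. s \<in> X \<Longrightarrow> holds M s \<psi> \<longleftrightarrow> \<beta> = Eloise"
  shows "has_uniform_winning_strategy M X (flatten \<psi>) \<beta>"
  unfolding has_uniform_winning_strategy_def
proof (intro exI conjI)
  show "is_strategy M (flatten \<psi>) \<beta> (favourable_moves M (flatten \<psi>) \<beta>)"
    using assms(1) by (rule is_strategy_favourable_moves)
  show "winning M X (flatten \<psi>) \<beta> (favourable_moves M (flatten \<psi>) \<beta>)"
    using assms(2) by (intro winning_favourable_moves) simp
  show "uniform M X (flatten \<psi>) \<beta> (favourable_moves M (flatten \<psi>) \<beta>)"
    by (simp add: uniform_def subfm_at_flatten)
qed

theorem theorem3p19:
  fixes \<Sigma> :: "('f, 'r) signature" and \<phi> :: "('f, 'r) fm"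
  assumes "sentence \<Sigma> \<phi>"
    and "consistent TYPE('m) \<Sigma> \<phi>"
  shows "logically_equivalent TYPE('m) \<Sigma> \<phi> (flatten \<phi>)"
  unfolding logically_equivalent_def
proof (intro allI impI)
  fix M :: "('f, 'r, 'm) model" and d
  assume M: "is_model \<Sigma> M"
  let ?X = "{Map.empty} :: 'm assignment set"
  let ?win = "has_uniform_winning_strategy M ?X"
  \<comment> \<open>For fixed \<open>\<psi>\<close> the right-hand sides for the two players exclude
    each other, so at most one of them has such a strategy.\<close>
  have sound: "holds M Map.empty \<psi> \<longleftrightarrow> \<beta> = Eloise" if "?win \<psi> \<beta>" for \<psi> \<beta>
    using uniform_winning_strategy_imp_holds[OF that] by simp
  have complete: "?win (flatten \<phi>) \<beta>" if "holds M Map.empty \<phi> \<longleftrightarrow> \<beta> = Eloise" for \<beta>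
    using M that by (intro uniform_winning_strategy_flatten) (auto simp: is_model_def)
  \<comment> \<open>Failure of \<open>sat Plus\<close> is a strategy for Abelard, failure of
    \<open>sat Minus\<close> one for Eloise.\<close>
  have "?win \<phi> Abelard \<or> ?win \<phi> Eloise"
    using assms(2) M by (auto simp: consistent_def sat_def)
  then have "?win \<phi> \<beta> \<longleftrightarrow> ?win (flatten \<phi>) \<beta>" for \<beta>
    using sound[of \<phi> Abelard] sound[of \<phi> Eloise]
      sound[of "flatten \<phi>" Abelard] sound[of "flatten \<phi>" Eloise] complete[of \<beta>]
    by (cases \<beta>) auto
  then show "sat d M \<phi> = sat d M (flatten \<phi>)"
    by (cases d) (simp_all add: sat_def)
qed

end
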